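(* There exists a numerical constant $c_2>0$ such that, for every strategy $\pi$ that uses neither the moment bound $u$ nor the moment order $\epsilon$, and for all $T\ge K\ge2$, $$\sup_{\epsilon\in(0,1]}\Phi_\epsilon^\pi(K,T)\ \ge\ c_2\,T .$$
   Context: Bandit model. There are $K\ge 2$ arms and a horizon of $T\ge1$ rounds. An instance is a tuple $\underline\nu=(\nu_1,\dots,\nu_K)$ of probability distributions on $\mathbb R$. Successive pulls of arm $i$ produce i.i.d. rewards from $\nu_i$, independently across arms. At each round $t$ the learner picks an arm $I_t\in\{1,\dots,K\}$ by a possibly randomized rule depending only on the history up to round $t-1$, and observes a reward of that arm. A strategy $\pi$ specifies such a rule for every $K$ and $T$; "uses neither $u$ nor $\epsilon$" means that the same rule is used for all instances, all moment orders $\epsilon$ and all moment bounds $u$. With $\mu_i=\mathbb E_{X\sim\nu_i}[X]$ and $\mu^*=\max_i\mu_i$, the expected regret is $R_T^\pi(\underline\nu)=\mathbb E_{\underline\nu,\pi}\big[\sum_{t=1}^T(\mu^*-\mu_{I_t})\big]$, the expectation being over rewards and the strategy's internal randomness. For $\epsilon\in(0,1]$ the intrinsic moment scale of an instance is $$U_\epsilon(\underline\nu)=\max_{i\in\{1,\dots,K\}}\big(\mathbb E_{X\sim\nu_i}[|X|^{1+\epsilon}]\big)^{\frac1{1+\epsilon}},$$ and the normalized regret profile of $\pi$ is $$\Phi_\epsilon^\pi(K,T)=\sup_{\underline\nu:\ 0<U_\epsilon(\underline\nu)<+\infty}\frac{R_T^\pi(\underline\nu)}{U_\epsilon(\underline\nu)},$$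 the supremum being over $K$-armed instances. *)

theory Defs
  imports "HOL-Probability.Probability"
begin

text \<open>
  Arms are \<open>1, \<dots>, K\<close>; rounds are counted from 0, so \<open>t\<close> is the number of rounds already played.
  A history of length \<open>t\<close> maps every \<open>s < t\<close> to the arm pulled and the reward observed in
  round \<open>s\<close>.
\<close>

definition histories :: "nat \<Rightarrow> nat \<Rightarrow> (nat \<Rightarrow> nat \<times> real) measure" where
  "histories K t = (\<Pi>\<^sub>M s\<in>{..<t}. count_space {1..K} \<Otimes>\<^sub>M borel)"

text \<open>
  A strategy \<open>\<pi>\<close> maps \<open>K\<close>, \<open>T\<close>, \<open>t\<close> and a history of length \<open>t\<close> to the conditional distribution
  of the next arm. Nothing else is passed to it, so it uses neither the instance
  nor any moment order or moment bound.
\<close>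

type_synonym strategy = "nat \<Rightarrow> nat \<Rightarrow> nat \<Rightarrow> (nat \<Rightarrow> nat \<times> real) \<Rightarrow> nat measure"

definition is_strategy :: "strategy \<Rightarrow> bool" where
  "is_strategy \<pi> \<longleftrightarrow> (\<forall>K\<ge>2. \<forall>T\<ge>1. \<forall>t<T.
     \<pi> K T t \<in> histories K t \<rightarrow>\<^sub>M prob_algebra (count_space {1..K}))"

type_synonym instance_tuple = "nat \<Rightarrow> real measure"

definition bandit_instance :: "nat \<Rightarrow> instance_tuple \<Rightarrow> bool" where
  "bandit_instance K \<nu> \<longleftrightarrow> (\<forall>i\<in>{1..K}. prob_space (\<nu> i) \<and> sets (\<nu> i) = sets borel)"

text \<open>
  The law of the first \<open>t\<close> rounds. Given the past, the next arm is drawn from the strategy and the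
  reward is a fresh draw from the distribution of that arm; this makes the successive rewards of
  each arm i.i.d. and independent across arms.
\<close>

primrec history_law ::
  "nat \<Rightarrow> instance_tuple \<Rightarrow> (nat \<Rightarrow> (nat \<Rightarrow> nat \<times> real) \<Rightarrow> nat measure) \<Rightarrow> nat
    \<Rightarrow> (nat \<Rightarrow> nat \<times> real) measure" where
  "history_law K \<nu> p 0 = return (histories K 0) (\<lambda>_. undefined)"
| "history_law K \<nu> p (Suc t) =
     history_law K \<nu> p t \<bind> (\<lambda>h. p t h \<bind> (\<lambda>i. \<nu> i \<bind> (\<lambda>x.
       return (histories K (Suc t)) (h(t := (i, x))))))"

definition mean :: "real measure \<Rightarrow> real" where
  "mean D = (\<integral>x. x \<partial>D)"

definition best_mean :: "nat \<Rightarrow> instance_tuple \<Rightarrow> real" where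
  "best_mean K \<nu> = (MAX i\<in>{1..K}. mean (\<nu> i))"

definition regret :: "strategy \<Rightarrow> nat \<Rightarrow> nat \<Rightarrow> instance_tuple \<Rightarrow> real" where
  "regret \<pi> K T \<nu> =
     (\<integral>h. (\<Sum>t<T. best_mean K \<nu> - mean (\<nu> (fst (h t)))) \<partial>history_law K \<nu> (\<pi> K T) T)"

definition ennreal_powr :: "ennreal \<Rightarrow> real \<Rightarrow> ennreal" where
  "ennreal_powr x a = (if x = \<infinity> then \<infinity> else ennreal (enn2real x powr a))"

definition moment_scale :: "nat \<Rightarrow> real \<Rightarrow> instance_tuple \<Rightarrow> ennreal" where
  "moment_scale K \<epsilon> \<nu> =
     (MAX i\<in>{1..K}. ennreal_powr (\<integral>\<^sup>+x. ennreal (\<bar>x\<bar> powr (1 + \<epsilon>)) \<partial>\<nu> i) (1 / (1 + \<epsilon>)))"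

definition regret_profile :: "strategy \<Rightarrow> real \<Rightarrow> nat \<Rightarrow> nat \<Rightarrow> ereal" where
  "regret_profile \<pi> \<epsilon> K T =
     (SUP \<nu>\<in>{\<nu>. bandit_instance K \<nu> \<and> 0 < moment_scale K \<epsilon> \<nu> \<and> moment_scale K \<epsilon> \<nu> < \<infinity>}.
        ereal (regret \<pi> K T \<nu> / enn2real (moment_scale K \<epsilon> \<nu>)))"

end

theory Submission
  imports Defs
begin

text \<open>
  Let \<open>p = 1 / (2T)\<close>. Replace one arm of the all-zero instance by a rare spike: the reward is
  \<open>1 / p\<close> with probability \<open>p\<close> and \<open>0\<close> otherwise, so its mean is 1. Since the spike
  dominates \<open>(1 - p) \<delta>\<^sub>0\<close>, the law of the \<open>T\<close> rounds dominates \<open>(1 - p)\<^sup>T \<ge> 1 / 2\<close>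
  times the law under the all-zero instance. Under the latter some arm is left
  unpulled for at least \<open>T / 2\<close> rounds in expectation; placing the spike there costs regret at
  least \<open>T / 4\<close>. Its moment scale is \<open>(2T)\<close> to the power \<open>\<epsilon> / (1 + \<epsilon>)\<close>, which is at most 2 for
  \<open>\<epsilon> = 1 / (2T)\<close>: a strategy that does not know \<open>\<epsilon>\<close> can be attacked with \<open>\<epsilon>\<close> tending to 0.
\<close>

subsection \<open>The law of the history\<close>

lemma measurable_append_round [measurable]:
  "(\<lambda>(h, y). h(t := y)) \<in> histories K t \<Otimes>\<^sub>M (count_space {1..K} \<Otimes>\<^sub>M borel)
     \<rightarrow>\<^sub>M histories K (Suc t)"
  unfolding histories_def lessThan_Suc by (rule measurable_add_dim)

lemma measurable_append_reward:
  assumes "h \<in> space (histories K t)" "i \<in> {1..K}"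
  shows "(\<lambda>x. h(t := (i, x))) \<in> borel \<rightarrow>\<^sub>M histories K (Suc t)"
proof -
  have "(\<lambda>x. (h, (i, x))) \<in> borel \<rightarrow>\<^sub>M histories K t \<Otimes>\<^sub>M (count_space {1..K} \<Otimes>\<^sub>M borel)"
    using assms by (intro measurable_Pair measurable_const measurable_ident) simp_all
  from measurable_compose[OF this measurable_append_round] show ?thesis
    by (simp only: prod.case)
qed

lemma measurable_reward_kernel:
  assumes "bandit_instance K \<nu>"
  shows "\<nu> \<in> count_space {1..K} \<rightarrow>\<^sub>M prob_algebra borel"
  using assms by (auto simp: bandit_instance_def space_prob_algebra)

text \<open>Naming one step of the recursion as a kernel from histories to longer histories lets the
  bind lemmas be applied one round at a time.\<close>

definition round_law where
  "round_law K \<nu> p t h = p t h \<bind> (\<lambda>i. \<nu> i \<bind> (\<lambda>x.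
     return (histories K (Suc t)) (h(t := (i, x)))))"

lemma measurable_round_reward:
  assumes "bandit_instance K \<nu>"
  shows "(\<lambda>(h, i). \<nu> i \<bind> (\<lambda>x. return (histories K (Suc t)) (h(t := (i, x)))))
    \<in> histories K t \<Otimes>\<^sub>M count_space {1..K} \<rightarrow>\<^sub>M prob_algebra (histories K (Suc t))"
proof -
  have append: "(\<lambda>x. (fst (fst x))(t := (snd (fst x), snd x)))
      \<in> (histories K t \<Otimes>\<^sub>M count_space {1..K}) \<Otimes>\<^sub>M borel \<rightarrow>\<^sub>M histories K (Suc t)"
    using measurable_compose[OF _ measurable_append_round,
        of "\<lambda>x. (fst (fst x), (snd (fst x), snd x))"] by simp
  show ?thesis
    unfolding case_prod_unfold
  proof (rule measurable_bind_prob_space2[where N=borel])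
    show "(\<lambda>x. \<nu> (snd x)) \<in> histories K t \<Otimes>\<^sub>M count_space {1..K} \<rightarrow>\<^sub>M prob_algebra borel"
      by (rule measurable_compose[OF measurable_snd measurable_reward_kernel[OF assms]])
    show "(\<lambda>(x, y). return (histories K (Suc t)) ((fst x)(t := (snd x, y))))
        \<in> (histories K t \<Otimes>\<^sub>M count_space {1..K}) \<Otimes>\<^sub>M borel \<rightarrow>\<^sub>M prob_algebra (histories K (Suc t))"
      unfolding case_prod_unfold
      by (rule measurable_compose[OF append measurable_return_prob_space])
  qed
qed

lemma measurable_round_law:
  assumes "bandit_instance K \<nu>"
    and "p t \<in> histories K t \<rightarrow>\<^sub>M prob_algebra (count_space {1..K})"
  shows "round_law K \<nu> p t \<in> histories K t \<rightarrow>\<^sub>M prob_algebra (histories K (Suc t))"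
  unfolding round_law_def
  by (rule measurable_bind_prob_space2[OF assms(2) measurable_round_reward[OF assms(1)]])

lemma history_law_Suc: "history_law K \<nu> p (Suc t) = history_law K \<nu> p t \<bind> round_law K \<nu> p t"
  by (simp add: round_law_def[abs_def])

lemma history_law_in_prob_algebra:
  assumes "bandit_instance K \<nu>"
    and "\<And>s. s < t \<Longrightarrow> p s \<in> histories K s \<rightarrow>\<^sub>M prob_algebra (count_space {1..K})"
  shows "history_law K \<nu> p t \<in> space (prob_algebra (histories K t))"
  using assms(2)
proof (induction t)
  case 0
  show ?case
    by (auto simp: space_prob_algebra histories_def space_PiM intro!: prob_space_return)
next
  case (Suc t)
  then have IH: "history_law K \<nu> p t \<in> space (prob_algebra (histories K t))"
    and R: "round_law K \<nu> p t \<in> histories K t \<rightarrow>\<^sub>M prob_algebra (histories K (Suc t))"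
    using measurable_round_law[OF assms(1)] by auto
  \<comment> \<open>The bind rule speaks of kernels, so the measure is treated as a constant kernel
    on \<open>unit\<close> and evaluated afterwards.\<close>
  have "(\<lambda>_::unit. history_law K \<nu> p t \<bind> round_law K \<nu> p t)
      \<in> count_space UNIV \<rightarrow>\<^sub>M prob_algebra (histories K (Suc t))"
    by (rule measurable_bind_prob_space[OF _ R]) (use IH in simp)
  then show ?case
    unfolding history_law_Suc by (auto dest: measurable_space)
qed

text \<open>This isolates the instance: the outer integral over the arm depends only on the
  strategy, and \<open>\<nu>\<close> enters only through the inner integral over the reward.\<close>

lemma nn_integral_round_law:
  assumes \<nu>: "bandit_instance K \<nu>"
    and p: "p t \<in> histories K t \<rightarrow>\<^sub>M prob_algebra (count_space {1..K})"
    and h: "h \<in> space (histories K t)"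
    and f [measurable]: "f \<in> borel_measurable (histories K (Suc t))"
  shows "(\<integral>\<^sup>+y. f y \<partial>round_law K \<nu> p t h) = (\<integral>\<^sup>+i. \<integral>\<^sup>+x. f (h(t := (i, x))) \<partial>\<nu> i \<partial>p t h)"
proof -
  have sets_p: "sets (p t h) = sets (count_space {1..K})"
    using measurable_space[OF p h] by (simp add: space_prob_algebra)
  have space_p: "space (p t h) = {1..K}"
    using sets_eq_imp_space_eq[OF sets_p] by simp
  have "(\<lambda>i. \<nu> i \<bind> (\<lambda>x. return (histories K (Suc t)) (h(t := (i, x)))))
      \<in> count_space {1..K} \<rightarrow>\<^sub>M prob_algebra (histories K (Suc t))"
    using measurable_compose[OF measurable_Pair1'[OF h] measurable_round_reward[OF \<nu>]]
    by (simp add: case_prod_unfold)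
  then have "(\<lambda>i. \<nu> i \<bind> (\<lambda>x. return (histories K (Suc t)) (h(t := (i, x)))))
      \<in> p t h \<rightarrow>\<^sub>M subprob_algebra (histories K (Suc t))"
    unfolding measurable_cong_sets[OF sets_p refl] by (rule measurable_prob_algebraD)
  note outer = nn_integral_bind[OF f this]
  have "(\<integral>\<^sup>+y. f y \<partial>(\<nu> i \<bind> (\<lambda>x. return (histories K (Suc t)) (h(t := (i, x))))))
      = (\<integral>\<^sup>+x. f (h(t := (i, x))) \<partial>\<nu> i)" if i: "i \<in> {1..K}" for i
  proof -
    have s: "sets (\<nu> i) = sets borel"
      using \<nu> i by (auto simp: bandit_instance_def)
    have m: "(\<lambda>x. h(t := (i, x))) \<in> \<nu> i \<rightarrow>\<^sub>M histories K (Suc t)"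
      unfolding measurable_cong_sets[OF s refl] by (rule measurable_append_reward[OF h i])
    show ?thesis
      by (subst nn_integral_bind[OF f measurable_compose[OF m return_measurable]])
         (intro nn_integral_cong nn_integral_return measurable_space[OF m] f)
  qed
  then show ?thesis
    unfolding round_law_def outer by (intro nn_integral_cong) (simp add: space_p)
qed

text \<open>A change of measure without densities. The strategy reacts identically to identical
  histories under both instances, so each round costs at most one factor \<open>a\<close>. The test
  function is arbitrary because the induction replaces it by its integral over the last
  round.\<close>

lemma history_law_dominates:
  assumes \<nu>: "bandit_instance K \<nu>" and \<nu>': "bandit_instance K \<nu>'"
    and p: "\<And>s. s < t \<Longrightarrow> p s \<in> histories K s \<rightarrow>\<^sub>M prob_algebra (count_space {1..K})"
    and dom: "\<And>i g. i \<in> {1..K} \<Longrightarrow> g \<in> borel_measurable borel \<Longrightarrow>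
      a * (\<integral>\<^sup>+x. g x \<partial>\<nu> i) \<le> (\<integral>\<^sup>+x. g x \<partial>\<nu>' i)"
    and f: "f \<in> borel_measurable (histories K t)"
  shows "a ^ t * (\<integral>\<^sup>+h. f h \<partial>history_law K \<nu> p t) \<le> (\<integral>\<^sup>+h. f h \<partial>history_law K \<nu>' p t)"
  using p f
proof (induction t arbitrary: f)
  case 0
  then show ?case by simp
next
  case (Suc t)
  note f [measurable] = Suc.prems(2)
  have pt: "p t \<in> histories K t \<rightarrow>\<^sub>M prob_algebra (count_space {1..K})"
    using Suc.prems(1) by simp
  have kernel: "round_law K \<xi> p t \<in> histories K t \<rightarrow>\<^sub>M subprob_algebra (histories K (Suc t))"
    and sets_law: "sets (history_law K \<xi> p t) = sets (histories K t)"
    if "bandit_instance K \<xi>" for \<xi>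
    using measurable_round_law[OF that, of p t, OF pt]
      history_law_in_prob_algebra[OF that, of t p] Suc.prems(1)
    by (auto simp: space_prob_algebra intro: measurable_prob_algebraD)
  have expand: "(\<integral>\<^sup>+h. f h \<partial>history_law K \<xi> p (Suc t))
      = (\<integral>\<^sup>+h. \<integral>\<^sup>+y. f y \<partial>round_law K \<xi> p t h \<partial>history_law K \<xi> p t)"
    if "bandit_instance K \<xi>" for \<xi>
    unfolding history_law_Suc
    by (rule nn_integral_bind[OF f])
       (simp add: kernel[OF that] measurable_cong_sets[OF sets_law[OF that] refl])
  have meas: "(\<lambda>h. \<integral>\<^sup>+y. f y \<partial>round_law K \<nu> p t h) \<in> borel_measurable (histories K t)"
    by (rule measurable_compose[OF kernel[OF \<nu>]]) measurable
  have step: "a * (\<integral>\<^sup>+y. f y \<partial>round_law K \<nu> p t h) \<le> (\<integral>\<^sup>+y. f y \<partial>round_law K \<nu>' p t h)"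
    if h: "h \<in> space (histories K t)" for h
  proof -
    have sets_p: "sets (p t h) = sets (count_space {1..K})"
      using measurable_space[OF pt h] by (simp add: space_prob_algebra)
    have sp: "space (p t h) = {1..K}"
      using sets_eq_imp_space_eq[OF sets_p] by simp
    have mp: "g \<in> borel_measurable (p t h)" for g :: "nat \<Rightarrow> ennreal"
      unfolding measurable_cong_sets[OF sets_p refl] by simp
    have "a * (\<integral>\<^sup>+x. f (h(t := (i, x))) \<partial>\<nu> i) \<le> (\<integral>\<^sup>+x. f (h(t := (i, x))) \<partial>\<nu>' i)"
      if i: "i \<in> {1..K}" for i
      by (intro dom i measurable_compose[OF measurable_append_reward[OF h i] f])
    then show ?thesis
      unfolding nn_integral_round_law[of K _ p t, OF \<nu> pt h f] nn_integral_round_law[of K _ p t, OF \<nu>' pt h f]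
        nn_integral_cmult[OF mp, symmetric]
      by (intro nn_integral_mono) (simp add: sp)
  qed
  have "a ^ Suc t * (\<integral>\<^sup>+h. f h \<partial>history_law K \<nu> p (Suc t))
      = a * (a ^ t * (\<integral>\<^sup>+h. \<integral>\<^sup>+y. f y \<partial>round_law K \<nu> p t h \<partial>history_law K \<nu> p t))"
    unfolding expand[OF \<nu>] by (simp add: mult.assoc)
  \<comment> \<open>The induction hypothesis exchanges the instance in the first \<open>t\<close>
    rounds; \<open>step\<close> then exchanges it in the last one.\<close>
  also have "\<dots> \<le> a * (\<integral>\<^sup>+h. \<integral>\<^sup>+y. f y \<partial>round_law K \<nu> p t h \<partial>history_law K \<nu>' p t)"
    using Suc.IH[OF _ meas] Suc.prems(1) by (intro mult_left_mono) auto
  also have "\<dots> = (\<integral>\<^sup>+h. a * (\<integral>\<^sup>+y. f y \<partial>round_law K \<nu> p t h) \<partial>history_law K \<nu>' p t)"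
    using meas by (subst nn_integral_cmult) (simp_all cong: measurable_cong_sets add: sets_law[OF \<nu>'])
  also have "\<dots> \<le> (\<integral>\<^sup>+h. \<integral>\<^sup>+y. f y \<partial>round_law K \<nu>' p t h \<partial>history_law K \<nu>' p t)"
    using step by (intro nn_integral_mono) (simp add: sets_eq_imp_space_eq[OF sets_law[OF \<nu>']])
  finally show ?case
    unfolding expand[OF \<nu>'] .
qed

subsection \<open>The spike distribution\<close>

definition spike :: "real \<Rightarrow> real measure" where
  "spike p = distr (bernoulli_pmf p) borel (\<lambda>b. if b then 1 / p else 0)"

lemma sets_spike [simp]: "sets (spike p) = sets borel"
  by (simp add: spike_def)

lemma prob_space_spike: "prob_space (spike p)"
  unfolding spike_def by (rule measure_pmf.prob_space_distr) simp

lemma nn_integral_spike: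
  assumes "0 \<le> p" "p \<le> 1" "f \<in> borel_measurable borel"
  shows "(\<integral>\<^sup>+x. f x \<partial>spike p) = f (1 / p) * ennreal p + f 0 * ennreal (1 - p)"
  unfolding spike_def using assms by (subst nn_integral_distr) simp_all

lemma mean_spike:
  assumes "0 < p" "p \<le> 1"
  shows "mean (spike p) = 1"
  unfolding mean_def spike_def using assms by (subst integral_distr) simp_all

lemma mean_return: "mean (return borel c) = c"
  unfolding mean_def by (subst integral_return) simp_all

definition spike_instance :: "nat \<Rightarrow> real \<Rightarrow> instance_tuple" where
  "spike_instance k p i = (if i = k then spike p else return borel 0)"

lemma bandit_instance_spike_instance: "bandit_instance K (spike_instance k p)"
  by (auto simp: bandit_instance_def spike_instance_def prob_space_spike prob_space_return)

lemma best_mean_spike_instance: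
  assumes "k \<in> {1..K}" "0 < p" "p \<le> 1"
  shows "best_mean K (spike_instance k p) = 1"
  unfolding best_mean_def using assms
  by (intro Max_eqI) (auto simp: spike_instance_def mean_spike mean_return
      intro!: image_eqI[where x=k])

text \<open>The moment of order \<open>1 + \<epsilon>\<close> of the spike is
  \<open>(1 / p) powr (1 + \<epsilon>) * p = (1 / p) powr \<epsilon>\<close>. The other arms
  contribute 0, so arm \<open>k\<close> attains the maximum.\<close>

lemma moment_scale_spike_instance:
  assumes "k \<in> {1..K}" "0 < p" "p \<le> 1" "0 < \<epsilon>"
  shows "moment_scale K \<epsilon> (spike_instance k p) = ennreal ((1 / p) powr (\<epsilon> / (1 + \<epsilon>)))"
proof -
  let ?m = "\<lambda>i. ennreal_powr (\<integral>\<^sup>+x. ennreal (\<bar>x\<bar> powr (1 + \<epsilon>)) \<partial>spike_instance k p i) (1 / (1 + \<epsilon>))"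
  have "(\<integral>\<^sup>+x. ennreal (\<bar>x\<bar> powr (1 + \<epsilon>)) \<partial>spike p) = ennreal ((1 / p) powr (1 + \<epsilon>) * p)"
    using assms by (subst nn_integral_spike) (simp_all add: ennreal_mult')
  also have "(1 / p) powr (1 + \<epsilon>) * p = (1 / p) powr \<epsilon>"
    using assms by (simp add: powr_add)
  finally have spike: "?m k = ennreal ((1 / p) powr (\<epsilon> / (1 + \<epsilon>)))"
    using assms by (simp add: spike_instance_def ennreal_powr_def powr_powr)
  have zero: "?m i = 0" if "i \<noteq> k" for i
    using that by (simp add: spike_instance_def ennreal_powr_def nn_integral_return)
  have "?m i \<le> ?m k" for i
    by (cases "i = k") (simp_all add: zero)
  then have "(MAX i\<in>{1..K}. ?m i) = ?m k"
    using assms(1) by (intro Max_eqI) auto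
  then show ?thesis
    unfolding moment_scale_def spike .
qed

text \<open>Arm \<open>k\<close> keeps an atom of mass \<open>1 - p\<close> at 0, and every other
  arm is itself the point mass at 0.\<close>

lemma spike_instance_dominates:
  assumes "0 \<le> p" "p \<le> 1" and g: "g \<in> borel_measurable borel"
  shows "ennreal (1 - p) * (\<integral>\<^sup>+x. g x \<partial>return borel 0) \<le> (\<integral>\<^sup>+x. g x \<partial>spike_instance k p i)"
proof -
  have "ennreal (1 - p) * g 0 \<le> 1 * g 0"
    using assms(1) by (intro mult_right_mono) (simp_all add: ennreal_le_1)
  then show ?thesis
    using assms by (simp add: spike_instance_def nn_integral_return nn_integral_spike mult.commute)
qed

subsection \<open>Regret\<close>

definition misses :: "nat \<Rightarrow> nat \<Rightarrow> (nat \<Rightarrow> nat \<times> real) \<Rightarrow> real" where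
  "misses k T h = (\<Sum>t<T. if fst (h t) = k then 0 else 1)"

lemma measurable_misses [measurable]: "misses k T \<in> borel_measurable (histories K T)"
proof -
  have [measurable]: "(\<lambda>h. h t) \<in> histories K T \<rightarrow>\<^sub>M count_space {1..K} \<Otimes>\<^sub>M borel" if "t < T" for t
    unfolding histories_def using that by simp
  have "(\<lambda>h. if fst (h t) = k then 0 else 1 :: real) \<in> borel_measurable (histories K T)"
    if "t < T" for t
    by (rule measurable_compose[OF measurable_compose[OF _ measurable_fst],
          where N="count_space {1..K}"]) (use that in measurable)
  then show ?thesis
    unfolding misses_def[abs_def] by (intro borel_measurable_sum) auto
qed

lemma misses_bounds: "0 \<le> misses k T h" "misses k T h \<le> real T"
proof -
  have "misses k T h \<le> (\<Sum>t<T. 1)"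
    unfolding misses_def by (intro sum_mono) simp
  then show "misses k T h \<le> real T" by simp
qed (simp add: misses_def sum_nonneg)

text \<open>Each round misses every arm except the one pulled.\<close>

lemma sum_misses:
  assumes "h \<in> space (histories K T)"
  shows "(\<Sum>k\<in>{1..K}. misses k T h) = real T * (real K - 1)"
proof -
  have "(\<Sum>k\<in>{1..K}. if fst (h t) = k then 0 else 1) = real K - 1" if "t < T" for t
  proof -
    have "h t \<in> space (count_space {1..K} \<Otimes>\<^sub>M borel)"
      using assms that by (auto simp: histories_def space_PiM)
    then have "fst (h t) \<in> {1..K}"
      by (auto simp: space_pair_measure)
    moreover have "(if fst (h t) = k then 0 else 1) = 1 - (if fst (h t) = k then 1 else 0 :: real)" for k
      by simp
    ultimately show ?thesis
      by (simp add: sum_subtractf)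
  qed
  then show ?thesis
    unfolding misses_def by (subst sum.swap) simp
qed

lemma integrable_misses:
  assumes "M \<in> space (prob_algebra (histories K T))"
  shows "integrable M (misses k T)"
proof -
  from assms have "prob_space M" and s: "sets M = sets (histories K T)"
    by (auto simp: space_prob_algebra)
  then interpret prob_space M by simp
  show ?thesis
    using misses_bounds[of k T]
    by (intro integrable_const_bound[where B="real T"]) (auto simp: measurable_cong_sets[OF s refl])
qed

text \<open>Pigeonhole: the expected misses average \<open>T * (1 - 1 / K)\<close> over the arms,
  which is at least \<open>T / 2\<close> since \<open>K\<close> is at least 2.\<close>

lemma exists_often_missed_arm:
  assumes M: "M \<in> space (prob_algebra (histories K T))" and "2 \<le> K"
  shows "\<exists>k\<in>{1..K}. real T / 2 \<le> (\<integral>h. misses k T h \<partial>M)"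
proof (rule ccontr)
  from M have "prob_space M" and s: "sets M = sets (histories K T)"
    by (auto simp: space_prob_algebra)
  then interpret prob_space M by simp
  assume "\<not> ?thesis"
  then have "(\<Sum>k\<in>{1..K}. \<integral>h. misses k T h \<partial>M) < (\<Sum>k\<in>{1..K}. real T / 2)"
    using \<open>2 \<le> K\<close> by (intro sum_strict_mono) (auto simp: not_le)
  also have "(\<Sum>k\<in>{1..K}. \<integral>h. misses k T h \<partial>M) = (\<integral>h. (\<Sum>k\<in>{1..K}. misses k T h) \<partial>M)"
    by (rule Bochner_Integration.integral_sum[symmetric]) (rule integrable_misses[OF M])
  also have "\<dots> = (\<integral>h. real T * (real K - 1) \<partial>M)"
    by (intro Bochner_Integration.integral_cong refl sum_misses)
       (simp add: sets_eq_imp_space_eq[OF s])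
  also have "\<dots> = real T * (real K - 1)"
    by (simp add: prob_space)
  finally have "real T * (real K - 1) < real T * (real K / 2)"
    by (simp add: mult.commute)
  moreover have "real T * (real K / 2) \<le> real T * (real K - 1)"
    using \<open>2 \<le> K\<close> by (intro mult_left_mono) simp_all
  ultimately show False by simp
qed

text \<open>The spike arm has mean 1 and all others mean 0, so every miss of arm \<open>k\<close>
  costs exactly 1.\<close>

lemma regret_spike_instance:
  assumes "k \<in> {1..K}" "0 < p" "p \<le> 1"
  shows "regret \<pi> K T (spike_instance k p)
    = (\<integral>h. misses k T h \<partial>history_law K (spike_instance k p) (\<pi> K T) T)"
  unfolding regret_def misses_def
  by (intro Bochner_Integration.integral_cong refl sum.cong)
     (simp_all add: best_mean_spike_instance[OF assms] mean_spike[OF assms(2,3)] mean_return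
       spike_instance_def)

section \<open>Choice of the spiked arm, its probability and the moment order\<close>

theorem corollary9:
  shows "\<exists>c\<^sub>2::real. c\<^sub>2 > 0 \<and>
    (\<forall>\<pi>. is_strategy \<pi> \<longrightarrow> (\<forall>K T. 2 \<le> K \<longrightarrow> K \<le> T \<longrightarrow>
      (SUP \<epsilon>\<in>{0<..1}. regret_profile \<pi> \<epsilon> K T) \<ge> ereal (c\<^sub>2 * real T)))"
proof (intro exI[of _ "1 / 8"] conjI allI impI)
  fix \<pi> :: strategy and K T :: nat
  assume \<pi>: "is_strategy \<pi>" and K: "2 \<le> K" "K \<le> T"
  have kernel: "\<pi> K T t \<in> histories K t \<rightarrow>\<^sub>M prob_algebra (count_space {1..K})" if "t < T" for t
    using \<pi> K that by (simp add: is_strategy_def)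
  define p where "p = 1 / (2 * real T)"
  have p: "0 < p" "p \<le> 1"
    using K by (simp_all add: p_def)
  define L where "L \<nu> = history_law K \<nu> (\<pi> K T) T" for \<nu>
  have L: "L \<nu> \<in> space (prob_algebra (histories K T))" if "bandit_instance K \<nu>" for \<nu>
    unfolding L_def using that kernel by (rule history_law_in_prob_algebra)
  let ?\<nu>\<^sub>0 = "\<lambda>_::nat. return borel 0 :: real measure"
  have \<nu>\<^sub>0: "bandit_instance K ?\<nu>\<^sub>0"
    by (simp add: bandit_instance_def prob_space_return)
  \<comment> \<open>The arm is chosen from the behaviour under the all-zero instance, which has
    scale 0 and serves only as a reference; the supremum is tested on the spiked instance.\<close>
  obtain k where k: "k \<in> {1..K}" and miss: "real T / 2 \<le> (\<integral>h. misses k T h \<partial>L ?\<nu>\<^sub>0)"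
    using exists_often_missed_arm[OF L[OF \<nu>\<^sub>0] K(1)] by blast
  let ?\<nu> = "spike_instance k p"
  have \<nu>: "bandit_instance K ?\<nu>"
    by (rule bandit_instance_spike_instance)
  \<comment> \<open>Domination is proved for nonnegative integrals, whereas the regret is a Bochner
    integral.\<close>
  have nn: "(\<integral>\<^sup>+h. ennreal (misses k T h) \<partial>L \<xi>) = ennreal (\<integral>h. misses k T h \<partial>L \<xi>)"
    if "bandit_instance K \<xi>" for \<xi>
    using integrable_misses[OF L[OF that]] misses_bounds by (intro nn_integral_eq_integral) auto
  have "ennreal (1 - p) ^ T * (\<integral>\<^sup>+h. ennreal (misses k T h) \<partial>L ?\<nu>\<^sub>0)
      \<le> (\<integral>\<^sup>+h. ennreal (misses k T h) \<partial>L ?\<nu>)"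
    unfolding L_def using p
    by (intro history_law_dominates[OF \<nu>\<^sub>0 \<nu> kernel] spike_instance_dominates) auto
  then have "ennreal ((1 - p) ^ T * (\<integral>h. misses k T h \<partial>L ?\<nu>\<^sub>0)) \<le> ennreal (\<integral>h. misses k T h \<partial>L ?\<nu>)"
    using p unfolding nn[OF \<nu>] nn[OF \<nu>\<^sub>0] by (simp add: ennreal_mult' ennreal_power)
  then have "(1 - p) ^ T * (\<integral>h. misses k T h \<partial>L ?\<nu>\<^sub>0) \<le> (\<integral>h. misses k T h \<partial>L ?\<nu>)"
    by (subst (asm) ennreal_le_iff) (simp_all add: misses_bounds integral_nonneg_AE)
  \<comment> \<open>Bernoulli's inequality gives \<open>(1 - p) ^ T \<ge> 1 - T * p\<close>, and
    \<open>T * p = 1 / 2\<close>.\<close>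
  moreover have "1 / 2 \<le> (1 - p) ^ T"
    using Bernoulli_inequality[of "- p" T] p K by (simp add: p_def)
  then have "1 / 2 * (real T / 2) \<le> (1 - p) ^ T * (\<integral>h. misses k T h \<partial>L ?\<nu>\<^sub>0)"
    using miss by (intro mult_mono) auto
  ultimately have regret: "real T / 4 \<le> regret \<pi> K T ?\<nu>"
    unfolding regret_spike_instance[OF k p] L_def by simp
  \<comment> \<open>The number \<open>p\<close> now plays a second role, as the moment order:
    \<open>\<epsilon> = p\<close>.\<close>
  define U where "U = (1 / p) powr (p / (1 + p))"
  have scale: "moment_scale K p ?\<nu> = ennreal U"
    unfolding U_def using k p by (intro moment_scale_spike_instance) auto
  have "0 < U"
    using p by (simp add: U_def)
  \<comment> \<open>From \<open>n \<le> 2 ^ n\<close> with \<open>n = 1 / p = 2 * T\<close>, raising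
    to the power \<open>p\<close> gives \<open>(1 / p) powr p \<le> 2\<close>.\<close>
  have "1 / p = real (2 * T)"
    by (simp add: p_def)
  also have "\<dots> \<le> 2 ^ (2 * T)"
    using less_exp[of "2 * T"] by (metis less_imp_le of_nat_le_iff of_nat_numeral of_nat_power)
  also have "\<dots> = 2 powr (1 / p)"
    by (simp add: p_def powr_realpow[symmetric])
  finally have "(1 / p) powr p \<le> (2 powr (1 / p)) powr p"
    using p by (intro powr_mono2) auto
  also have "\<dots> = 2"
    using p by (simp add: powr_powr)
  finally have "(1 / p) powr p \<le> 2" .
  \<comment> \<open>The base \<open>1 / p\<close> is at least 1 and the exponent
    \<open>p / (1 + p)\<close> is at most \<open>p\<close>.\<close>
  moreover have "U \<le> (1 / p) powr p"
    unfolding U_def using p by (intro powr_mono) (auto simp: field_simps)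
  ultimately have "U \<le> 2" by simp
  \<comment> \<open>The constant 1/8 collects three factors 1/2: from the domination, from the often
    missed arm and from the moment scale.\<close>
  have "1 / 8 * real T = (real T / 4) / 2"
    by simp
  also have "\<dots> \<le> regret \<pi> K T ?\<nu> / U"
    using regret \<open>0 < U\<close> \<open>U \<le> 2\<close> by (intro frac_le) auto
  finally have "ereal (1 / 8 * real T) \<le> ereal (regret \<pi> K T ?\<nu> / enn2real (moment_scale K p ?\<nu>))"
    using \<open>0 < U\<close> by (simp add: scale)
  also have "\<dots> \<le> regret_profile \<pi> p K T"
    unfolding regret_profile_def using \<nu> \<open>0 < U\<close> by (intro SUP_upper) (simp add: scale)
  also have "\<dots> \<le> (SUP \<epsilon>\<in>{0<..1}. regret_profile \<pi> \<epsilon> K T)"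
    using p by (intro SUP_upper) simp
  finally show "ereal (1 / 8 * real T) \<le> (SUP \<epsilon>\<in>{0<..1}. regret_profile \<pi> \<epsilon> K T)" .
qed simp

end
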